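(* Let $r\geq 3$, let $\mathfrak{g}=\mathfrak{sp}_{2r}(\mathbb{C})$ be the simple Lie algebra of type $C_r$, and let $\tilde{\alpha}=\alpha_1+\cdots+\alpha_r$ be the sum of its simple roots. Then $|\mathcal{A}_r(\tilde{\alpha},0)|=\tilde{F}_{r-2}$.
   Context: Let $W$ be the Weyl group, generated by the simple reflections $s_1,\dots,s_r$, and $\rho$ half the sum of the positive roots. The simple roots of type $C_r$ are numbered so that $\alpha_r$ is the long simple root and $\alpha_i,\alpha_{i+1}$ are adjacent in the Dynkin diagram. Kostant's partition function $\wp(\xi)$ is the number of ways to write $\xi\in\mathfrak{h}^*$ as a nonnegative integral sum of positive roots. The Weyl alternation set of integral weights $\lambda,\mu$ is $\mathcal{A}(\lambda,\mu)=\{\sigma\in W:\wp(\sigma(\lambda+\rho)-(\mu+\rho))>0\}$, written $\mathcal{A}_r(\lambda,\mu)$ to indicate the rank $r$. The sequence $\tilde{F}_n$ ($n\ge1$) is defined by $\tilde F_1=2$, $\tilde F_2=6$ and $\tilde{F}_n=\tilde{F}_{n-1}+\tilde{F}_{n-2}$ for $n\ge 3$. *)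

theory Defs
  imports
    "Jordan_Normal_Form.Matrix"
    "HOL-Library.Function_Algebras"
    "HOL-Library.Multiset"
    "HOL-Algebra.Bij"
    "HOL-Algebra.Generated_Groups"
begin

section \<open>The Lie algebra of type C and its root system\<close>

definition symplectic_form :: "nat \<Rightarrow> complex mat" where
  "symplectic_form r =
     four_block_mat (0\<^sub>m r r) (1\<^sub>m r) (- 1\<^sub>m r) (0\<^sub>m r r)"

definition sp :: "nat \<Rightarrow> complex mat set" where
  "sp r = {X \<in> carrier_mat (2 * r) (2 * r).
     transpose_mat X * symplectic_form r + symplectic_form r * X = 0\<^sub>m (2 * r) (2 * r)}"

text \<open>The elements of \<open>cartan r\<close> are the matrices
  \<open>diag (a\<^sub>1, \<dots>, a\<^sub>r, -a\<^sub>1, \<dots>, -a\<^sub>r)\<close>.\<close>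

definition cartan :: "nat \<Rightarrow> complex mat set" where
  "cartan r = {H \<in> sp r. diagonal_mat H}"

text \<open>An element of the dual of the Cartan subalgebra is represented by its coordinates
  with respect to the basis \<open>\<epsilon>\<^sub>1, \<dots>, \<epsilon>\<^sub>r\<close>, where
  \<open>\<epsilon>\<^sub>i (diag (a\<^sub>1, \<dots>, a\<^sub>r, -a\<^sub>1, \<dots>, -a\<^sub>r)) = a\<^sub>i\<close>.
  Coordinates are numbered from 1, matrix entries from 0.\<close>

type_synonym weight = "nat \<Rightarrow> complex"

definition cartan_dual :: "nat \<Rightarrow> weight set" where
  "cartan_dual r = {\<xi>. \<forall>i. i \<notin> {1..r} \<longrightarrow> \<xi> i = 0}"

definition pairing :: "nat \<Rightarrow> weight \<Rightarrow> complex mat \<Rightarrow> complex" where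
  "pairing r \<xi> H = (\<Sum>i = 1..r. \<xi> i * H $$ (i - 1, i - 1))"

definition roots :: "nat \<Rightarrow> weight set" where
  "roots r = {\<beta> \<in> cartan_dual r. \<beta> \<noteq> 0 \<and>
     (\<exists>X \<in> sp r. X \<noteq> 0\<^sub>m (2 * r) (2 * r) \<and>
        (\<forall>H \<in> cartan r. H * X - X * H = pairing r \<beta> H \<cdot>\<^sub>m X))}"

definition eps :: "nat \<Rightarrow> weight" where
  "eps i = (\<lambda>k. if k = i then 1 else 0)"

text \<open>The standard base; \<open>simple_root r r\<close> is the long simple root, and consecutive simple
  roots are adjacent in the Dynkin diagram. Only the indices \<open>1, \<dots>, r\<close> are meaningful.\<close>

definition simple_root :: "nat \<Rightarrow> nat \<Rightarrow> weight" where
  "simple_root r i = (if i < r then eps i - eps (i + 1) else eps r + eps r)"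

definition positive_roots :: "nat \<Rightarrow> weight set" where
  "positive_roots r = {\<beta> \<in> roots r.
     \<exists>c :: nat \<Rightarrow> nat. \<beta> = (\<Sum>i = 1..r. (\<lambda>k. of_nat (c i) * simple_root r i k))}"

definition half_sum_positive_roots :: "nat \<Rightarrow> weight" where
  "half_sum_positive_roots r = (\<lambda>k. (1 / 2) * (\<Sum>\<beta> \<in> positive_roots r. \<beta> k))"


section \<open>The Weyl group\<close>

text \<open>Up to a nonzero scalar, which does not affect reflections, this is the bilinear form
  induced by the Killing form (no complex conjugation is involved).\<close>

definition weight_form :: "nat \<Rightarrow> weight \<Rightarrow> weight \<Rightarrow> complex" where
  "weight_form r \<xi> \<eta> = (\<Sum>i = 1..r. \<xi> i * \<eta> i)"

definition reflection :: "nat \<Rightarrow> weight \<Rightarrow> weight \<Rightarrow> weight" where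
  "reflection r \<beta> = (\<lambda>\<xi> \<in> cartan_dual r. \<lambda>k.
     \<xi> k - 2 * weight_form r \<xi> \<beta> / weight_form r \<beta> \<beta> * \<beta> k)"

definition simple_reflection :: "nat \<Rightarrow> nat \<Rightarrow> weight \<Rightarrow> weight" where
  "simple_reflection r i = reflection r (simple_root r i)"

definition weyl_group :: "nat \<Rightarrow> (weight \<Rightarrow> weight) set" where
  "weyl_group r = generate (BijGroup (cartan_dual r)) (simple_reflection r ` {1..r})"


section \<open>Kostant's partition function and Weyl alternation sets\<close>

text \<open>The way of writing \<open>\<xi>\<close> in which each positive root \<open>\<beta>\<close> has coefficient \<open>m\<^sub>\<beta>\<close> is encoded
  as the multiset containing each \<open>\<beta>\<close> exactly \<open>m\<^sub>\<beta>\<close> times. All positive roots lie in an open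
  half-space, so there are only finitely many such multisets.\<close>

definition kostant_partition :: "nat \<Rightarrow> weight \<Rightarrow> nat" where
  "kostant_partition r \<xi> = card {M. set_mset M \<subseteq> positive_roots r \<and> \<Sum>\<^sub># M = \<xi>}"

definition weyl_alternation_set :: "nat \<Rightarrow> weight \<Rightarrow> weight \<Rightarrow> (weight \<Rightarrow> weight) set" where
  "weyl_alternation_set r lam mu = {\<sigma> \<in> weyl_group r.
     kostant_partition r
       (\<sigma> (lam + half_sum_positive_roots r) - (mu + half_sum_positive_roots r)) > 0}"


text \<open>The sequence starts at index 1; the value at 0 is a dummy.\<close>

fun F_tilde :: "nat \<Rightarrow> nat" where
  "F_tilde 0 = 0"
| "F_tilde (Suc 0) = 2"
| "F_tilde (Suc (Suc 0)) = 6"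
| "F_tilde (Suc (Suc (Suc n))) = F_tilde (Suc (Suc n)) + F_tilde (Suc n)"

end

theory Submission
  imports Defs "HOL-Combinatorics.Multiset_Permutations"
begin

text \<open>
  In the coordinates \<open>\<epsilon>\<^sub>1, \<dots>, \<epsilon>\<^sub>r\<close>, the Weyl group consists of signed permutations,
  \<open>\<rho> = (r, r - 1, \<dots>, 1)\<close>, and \<open>\<alpha>\<^sub>1 + \<dots> + \<alpha>\<^sub>r = \<epsilon>\<^sub>1 + \<epsilon>\<^sub>r\<close>. Hence the weight
  being permuted is \<open>(r + 1, r - 1, r - 2, \<dots>, 3, 2, 2)\<close>. A weight is a sum of positive roots iff it is
  a nonnegative integral combination of simple roots (\<open>kostant_partition_pos_iff\<close>), that is, iff the
  partial sums of its coordinates are nonnegative integers and the total is even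
  (\<open>root_combination_iff_partial_sums\<close>).

  Let \<open>v\<close> be a signed rearrangement of the weight above. Without signs the coordinates of \<open>v - \<rho>\<close>
  add up to 2. Every entry is at least 2, so a negative sign would make the total negative
  (\<open>kostant_partition_signed_perm_posD\<close>). So only permutations contribute, and parity is automatic. All
  permutations belong to the Weyl group, distinct permutations are distinct elements of it, and it
  remains to count the orders of the entries for which the partial sums of \<open>v - \<rho>\<close> are nonnegative;
  the two equal entries are distinguished.

  The first entry must be \<open>r + 1\<close>, which makes the partial sum 1. Suppose that the partial sum is 1
  and that the entries \<open>m, m - 1, \<dots>, 3, 2, 2\<close> are to be placed above \<open>m, m - 1, \<dots>, 1\<close>. If
  \<open>m \<ge> 4\<close>, then either \<open>m\<close> comes next, or \<open>m - 1\<close> and then \<open>m\<close> come next; both times the partial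
  sum is 1 again afterwards (\<open>arrangements_step\<close>). If \<open>m\<close> is 2 or 3, every order is admissible, which
  gives 2 and 6 possibilities. This is the recursion defining \<open>F_tilde\<close>, and \<open>m = r - 1\<close> at the
  start.

  The root system and \<open>\<rho>\<close> are computed from the matrix description of the Lie algebra
  (\<open>roots_eq\<close>, \<open>positive_roots_eq\<close>, \<open>half_sum_positive_roots_nth\<close>).
\<close>

section \<open>Nonnegative integral combinations of simple roots\<close>

lemma sum_fun_apply: "(\<Sum>i\<in>A. f i) k = (\<Sum>i\<in>A. f i k)"
  by (induction A rule: infinite_finite_induct) auto

text \<open>The combination of the simple roots with coefficients \<open>c 1, \<dots>, c r\<close>; other values of \<open>c\<close>
  are irrelevant.\<close>

definition root_combination :: "nat \<Rightarrow> (nat \<Rightarrow> nat) \<Rightarrow> weight" where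
  "root_combination r c = (\<Sum>i = 1..r. (\<lambda>k. of_nat (c i) * simple_root r i k))"

lemma root_combination_nth:
  assumes "1 \<le> r"
  shows "root_combination r c k =
    (if k \<in> {1..r}
     then (if k = r then 2 else 1) * of_nat (c k) - (if k = 1 then 0 else of_nat (c (k - 1)))
     else 0)"
proof -
  have "root_combination r c k = (\<Sum>i = 1..r. of_nat (c i) * simple_root r i k)"
    by (simp add: root_combination_def sum_fun_apply)
  also have "\<dots> = (\<Sum>i = 1..r. (if i = k then (if k = r then 2 else 1) * of_nat (c k) else 0)
      - (if i = k - 1 then (if 2 \<le> k \<and> k \<le> r then of_nat (c (k - 1)) else 0) else 0))"
    by (intro sum.cong) (auto simp: simple_root_def eps_def)
  also have "\<dots> = (if k \<in> {1..r} then (if k = r then 2 else 1) * of_nat (c k) else 0)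
      - (if k - 1 \<in> {1..r} then (if 2 \<le> k \<and> k \<le> r then of_nat (c (k - 1)) else 0) else 0)"
    by (simp only: sum_subtractf) (simp)
  finally show ?thesis using assms by auto
qed

lemma root_combination_in_cartan_dual: "1 \<le> r \<Longrightarrow> root_combination r c \<in> cartan_dual r"
  by (simp add: cartan_dual_def root_combination_nth)

text \<open>The first \<open>k\<close> coordinates of a combination of simple roots add up to its coefficient at
  \<open>\<alpha>\<^sub>k\<close>, doubled for the long root \<open>\<alpha>\<^sub>r\<close>. So partial sums of coordinates
  recover the coefficients.\<close>

lemma sum_root_combination:
  assumes "1 \<le> k" "k \<le> r"
  shows "(\<Sum>i = 1..k. root_combination r c i) = (if k = r then 2 else 1) * of_nat (c k)"
  using assms
proof (induction k rule: dec_induct)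
  case base
  then show ?case by (simp add: root_combination_nth)
next
  case (step n)
  then show ?case by (simp add: root_combination_nth)
qed

lemma cartan_dual_eqI:
  assumes "\<xi> \<in> cartan_dual r" "\<eta> \<in> cartan_dual r"
    and sums: "\<And>k. 1 \<le> k \<Longrightarrow> k \<le> r \<Longrightarrow> (\<Sum>i = 1..k. \<xi> i) = (\<Sum>i = 1..k. \<eta> i)"
  shows "\<xi> = \<eta>"
proof
  fix k
  show "\<xi> k = \<eta> k"
  proof (cases "1 \<le> k \<and> k \<le> r")
    case True
    then obtain n where n: "k = Suc n" by (cases k) auto
    have "(\<Sum>i = 1..n. \<xi> i) = (\<Sum>i = 1..n. \<eta> i)"
      using sums[of n] True n by (cases "n = 0") auto
    then show ?thesis using sums[of k] True n by simp
  qed (use assms in \<open>auto simp: cartan_dual_def\<close>)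
qed

lemma root_combination_0: "root_combination r (\<lambda>_. 0) = 0"
  by (auto simp: root_combination_def sum_fun_apply fun_eq_iff)

lemma root_combination_add:
  "root_combination r (\<lambda>i. c i + d i) = root_combination r c + root_combination r d"
  by (auto simp: root_combination_def sum_fun_apply fun_eq_iff sum.distrib algebra_simps)

text \<open>An integral weight is a nonnegative integral combination of simple roots iff all partial
  sums of its coordinates are nonnegative and their total is even.\<close>

lemma root_combination_iff_partial_sums:
  assumes "1 \<le> r" and \<xi>: "\<xi> \<in> cartan_dual r"
    and z: "\<And>i. i \<in> {1..r} \<Longrightarrow> \<xi> i = of_int (z i)"
  shows "(\<exists>c. \<xi> = root_combination r c) \<longleftrightarrow>
    (\<forall>k\<in>{1..r}. 0 \<le> (\<Sum>i = 1..k. z i)) \<and> even (\<Sum>i = 1..r. z i)"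
proof -
  have sums: "(\<Sum>i = 1..k. \<xi> i) = of_int (\<Sum>i = 1..k. z i)" if "k \<le> r" for k
    unfolding of_int_sum by (intro sum.cong) (use z that in auto)
  show ?thesis
  proof (intro iffI conjI ballI)
    assume "\<exists>c. \<xi> = root_combination r c"
    then obtain c where c: "\<xi> = root_combination r c" by blast
    have eq: "(\<Sum>i = 1..k. z i) = (if k = r then 2 else 1) * int (c k)" if "k \<in> {1..r}" for k
    proof -
      have "of_int (\<Sum>i = 1..k. z i) = (of_int ((if k = r then 2 else 1) * int (c k)) :: complex)"
        using sum_root_combination[of k r c] sums[of k] that c by auto
      then show ?thesis by (simp only: of_int_eq_iff)
    qed
    show "0 \<le> (\<Sum>i = 1..k. z i)" if "k \<in> {1..r}" for k
      using eq[OF that] by simp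
    show "even (\<Sum>i = 1..r. z i)"
      using eq[of r] assms(1) by simp
  next
    assume A: "(\<forall>k\<in>{1..r}. 0 \<le> (\<Sum>i = 1..k. z i)) \<and> even (\<Sum>i = 1..r. z i)"
    define c where "c k = nat ((\<Sum>i = 1..k. z i) div (if k = r then 2 else 1))" for k
    have c: "(if k = r then 2 else 1) * int (c k) = (\<Sum>i = 1..k. z i)" if "k \<in> {1..r}" for k
      using A that by (auto simp: c_def)
    have "\<xi> = root_combination r c"
    proof (rule cartan_dual_eqI[OF \<xi> root_combination_in_cartan_dual[OF assms(1)]])
      fix k assume k: "1 \<le> k" "k \<le> r"
      have "(\<Sum>i = 1..k. \<xi> i) = of_int ((if k = r then 2 else 1) * int (c k))"
        using c[of k] sums[of k] k by simp
      also have "\<dots> = (\<Sum>i = 1..k. root_combination r c i)"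
        using sum_root_combination[OF k, of c] by simp
      finally show "(\<Sum>i = 1..k. \<xi> i) = (\<Sum>i = 1..k. root_combination r c i)" .
    qed
    then show "\<exists>c. \<xi> = root_combination r c" by blast
  qed
qed

section \<open>The roots of the symplectic Lie algebra\<close>

text \<open>The index of the only nonzero entry of \<open>symplectic_form r\<close> in row \<open>p\<close>, and that entry.\<close>

definition conj_index :: "nat \<Rightarrow> nat \<Rightarrow> nat" where
  "conj_index r p = (if p < r then p + r else p - r)"

definition index_sign :: "nat \<Rightarrow> nat \<Rightarrow> complex" where
  "index_sign r p = (if p < r then 1 else - 1)"

lemma conj_index_less [simp]: "p < 2 * r \<Longrightarrow> conj_index r p < 2 * r"
  by (auto simp: conj_index_def)

lemma conj_index_conj_index [simp]: "p < 2 * r \<Longrightarrow> conj_index r (conj_index r p) = p"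
  by (auto simp: conj_index_def)

lemma index_sign_conj_index [simp]: "p < 2 * r \<Longrightarrow> index_sign r (conj_index r p) = - index_sign r p"
  by (auto simp: conj_index_def index_sign_def)

lemma symplectic_form_nth:
  assumes "i < 2 * r" "j < 2 * r"
  shows "symplectic_form r $$ (i, j) = (if j = conj_index r i then index_sign r i else 0)"
  using assms by (auto simp: symplectic_form_def conj_index_def index_sign_def)

lemma symplectic_form_dim [simp]:
  "dim_row (symplectic_form r) = 2 * r" "dim_col (symplectic_form r) = 2 * r"
  by (auto simp: symplectic_form_def)

lemma symplectic_form_mult_nth:
  assumes X: "X \<in> carrier_mat (2 * r) (2 * r)" and ij: "i < 2 * r" "j < 2 * r"
  shows "(symplectic_form r * X) $$ (i, j) = index_sign r i * X $$ (conj_index r i, j)"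
proof -
  have "(symplectic_form r * X) $$ (i, j) =
      (\<Sum>k = 0..<2 * r. symplectic_form r $$ (i, k) * X $$ (k, j))"
    using X ij by (simp add: scalar_prod_def)
  also have "\<dots> = (\<Sum>k = 0..<2 * r. if k = conj_index r i then index_sign r i * X $$ (k, j) else 0)"
    by (intro sum.cong) (use ij in \<open>auto simp: symplectic_form_nth\<close>)
  also have "\<dots> = index_sign r i * X $$ (conj_index r i, j)"
    using ij by (simp)
  finally show ?thesis .
qed

lemma transpose_mult_symplectic_form_nth:
  assumes X: "X \<in> carrier_mat (2 * r) (2 * r)" and ij: "i < 2 * r" "j < 2 * r"
  shows "(transpose_mat X * symplectic_form r) $$ (i, j) = - index_sign r j * X $$ (conj_index r j, i)"
proof -
  have "(transpose_mat X * symplectic_form r) $$ (i, j) =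
      (\<Sum>k = 0..<2 * r. X $$ (k, i) * symplectic_form r $$ (k, j))"
    using X ij by (simp add: scalar_prod_def)
  also have "\<dots> = (\<Sum>k = 0..<2 * r. if k = conj_index r j then - index_sign r j * X $$ (k, i) else 0)"
    by (intro sum.cong) (use ij in \<open>auto simp: symplectic_form_nth\<close>)
  also have "\<dots> = - index_sign r j * X $$ (conj_index r j, i)"
    using ij by (simp)
  finally show ?thesis .
qed

text \<open>Entrywise, membership in \<open>sp r\<close> says that the matrix \<open>symplectic_form r * X\<close> is symmetric.\<close>

lemma sp_iff:
  "X \<in> sp r \<longleftrightarrow> X \<in> carrier_mat (2 * r) (2 * r) \<and>
    (\<forall>i < 2 * r. \<forall>j < 2 * r.
       index_sign r i * X $$ (conj_index r i, j) = index_sign r j * X $$ (conj_index r j, i))"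
proof (cases "X \<in> carrier_mat (2 * r) (2 * r)")
  case X: True
  have "transpose_mat X * symplectic_form r + symplectic_form r * X = 0\<^sub>m (2 * r) (2 * r) \<longleftrightarrow>
    (\<forall>i < 2 * r. \<forall>j < 2 * r. (transpose_mat X * symplectic_form r) $$ (i, j)
        + (symplectic_form r * X) $$ (i, j) = 0)"
    using X by (auto simp: mat_eq_iff simp del: index_mult_mat(1))
  then show ?thesis
    using X by (auto simp: sp_def symplectic_form_mult_nth transpose_mult_symplectic_form_nth
        simp del: index_mult_mat(1))
qed (simp add: sp_def)

text \<open>The weight by which \<open>cartan r\<close> acts on the standard basis vector with index \<open>p\<close> (counted
  from 0): \<open>\<epsilon>\<^sub>1, \<dots>, \<epsilon>\<^sub>r, -\<epsilon>\<^sub>1, \<dots>, -\<epsilon>\<^sub>r\<close>.\<close>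

definition row_weight :: "nat \<Rightarrow> nat \<Rightarrow> weight" where
  "row_weight r p = (if p < r then eps (p + 1) else - eps (p - r + 1))"

lemma row_weight_conj_index: "p < 2 * r \<Longrightarrow> row_weight r (conj_index r p) = - row_weight r p"
  by (auto simp: row_weight_def conj_index_def)

lemma row_weight_in_cartan_dual: "p < 2 * r \<Longrightarrow> row_weight r p \<in> cartan_dual r"
  by (auto simp: row_weight_def cartan_dual_def eps_def)

lemma cartan_conj_index:
  assumes "H \<in> cartan r" "p < 2 * r"
  shows "H $$ (conj_index r p, conj_index r p) = - H $$ (p, p)"
proof -
  have "index_sign r (conj_index r p) * H $$ (conj_index r (conj_index r p), p) =
      index_sign r p * H $$ (conj_index r p, conj_index r p)"
    using assms sp_iff[of H r] conj_index_less[OF assms(2)] unfolding cartan_def by blast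
  then have "index_sign r p * (- H $$ (p, p)) = index_sign r p * H $$ (conj_index r p, conj_index r p)"
    using assms(2) by simp
  then show ?thesis
    by (simp add: index_sign_def split: if_splits)
qed

lemma pairing_diff: "pairing r (\<xi> - \<eta>) H = pairing r \<xi> H - pairing r \<eta> H"
  by (simp add: pairing_def sum_subtractf algebra_simps)

lemma pairing_eps:
  assumes "1 \<le> i" "i \<le> r"
  shows "pairing r (eps i) H = H $$ (i - 1, i - 1)"
proof -
  have "pairing r (eps i) H = (\<Sum>j = 1..r. if j = i then H $$ (j - 1, j - 1) else 0)"
    unfolding pairing_def by (intro sum.cong) (auto simp: eps_def)
  then show ?thesis using assms by (simp)
qed

lemma pairing_row_weight:
  assumes "H \<in> cartan r" "p < 2 * r"
  shows "pairing r (row_weight r p) H = H $$ (p, p)"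
proof (cases "p < r")
  case True
  then show ?thesis by (simp add: row_weight_def pairing_eps)
next
  case False
  have "pairing r (0 - eps (p - r + 1)) H = - H $$ (p - r, p - r)"
    unfolding pairing_diff using False assms(2) pairing_eps[of "p - r + 1" r H] by (simp add: pairing_def)
  then show ?thesis
    using False assms(2) cartan_conj_index[OF assms] by (simp add: row_weight_def conj_index_def)
qed

text \<open>The matrix \<open>diag (a\<^sub>1, \<dots>, a\<^sub>r, -a\<^sub>1, \<dots>, -a\<^sub>r)\<close> with \<open>a\<^sub>i = 1\<close> and
  all other \<open>a\<^sub>j = 0\<close>. For \<open>i = 1, \<dots>, r\<close> these form the basis of the Cartan subalgebra dual to
  \<open>\<epsilon>\<^sub>1, \<dots>, \<epsilon>\<^sub>r\<close>.\<close>

definition cartan_basis :: "nat \<Rightarrow> nat \<Rightarrow> complex mat" where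
  "cartan_basis r i = mat (2 * r) (2 * r) (\<lambda>(p, q). if p = q then row_weight r p i else 0)"

lemma cartan_basis_in_cartan: "cartan_basis r i \<in> cartan r"
proof -
  have "cartan_basis r i \<in> sp r"
    unfolding sp_iff
  proof (intro conjI allI impI)
    fix p q assume pq: "p < 2 * r" "q < 2 * r"
    show "index_sign r p * cartan_basis r i $$ (conj_index r p, q) =
        index_sign r q * cartan_basis r i $$ (conj_index r q, p)"
    proof (cases "q = conj_index r p")
      case True
      then show ?thesis using pq by (simp add: cartan_basis_def row_weight_conj_index)
    next
      case False
      then have "p \<noteq> conj_index r q" using pq by auto
      with False show ?thesis using pq by (auto simp: cartan_basis_def)
    qed
  qed (simp add: cartan_basis_def)
  then show ?thesis by (simp add: cartan_def diagonal_mat_def cartan_basis_def)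
qed

lemma pairing_cartan_basis:
  assumes "i \<in> {1..r}"
  shows "pairing r \<xi> (cartan_basis r i) = \<xi> i"
proof -
  have row: "row_weight r (j - 1) = eps j" if "j \<in> {1..r}" for j
    using that by (auto simp: row_weight_def)
  have "pairing r \<xi> (cartan_basis r i) = (\<Sum>j = 1..r. if j = i then \<xi> j else 0)"
    unfolding pairing_def
    by (intro sum.cong) (auto simp: cartan_basis_def row[unfolded One_nat_def] eps_def)
  then show ?thesis using assms by (simp)
qed

lemma cartan_commutator_nth:
  assumes H: "H \<in> cartan r" and X: "X \<in> carrier_mat (2 * r) (2 * r)" and pq: "p < 2 * r" "q < 2 * r"
  shows "(H * X - X * H) $$ (p, q) = (H $$ (p, p) - H $$ (q, q)) * X $$ (p, q)"
proof -
  have Hc: "H \<in> carrier_mat (2 * r) (2 * r)" and diag: "i < 2 * r \<Longrightarrow> j < 2 * r \<Longrightarrow> i \<noteq> j \<Longrightarrow> H $$ (i, j) = 0" for i j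
    using H by (auto simp: cartan_def sp_def diagonal_mat_def)
  have "(H * X) $$ (p, q) = (\<Sum>k = 0..<2 * r. H $$ (p, k) * X $$ (k, q))"
    using Hc X pq by (simp add: scalar_prod_def)
  also have "\<dots> = (\<Sum>k = 0..<2 * r. if k = p then H $$ (p, p) * X $$ (k, q) else 0)"
    by (intro sum.cong) (use diag pq in auto)
  finally have "(H * X) $$ (p, q) = H $$ (p, p) * X $$ (p, q)"
    using pq by simp
  moreover have "(X * H) $$ (p, q) = X $$ (p, q) * H $$ (q, q)"
  proof -
    have "(X * H) $$ (p, q) = (\<Sum>k = 0..<2 * r. X $$ (p, k) * H $$ (k, q))"
      using Hc X pq by (simp add: scalar_prod_def)
    also have "\<dots> = (\<Sum>k = 0..<2 * r. if k = q then X $$ (p, k) * H $$ (q, q) else 0)"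
      by (intro sum.cong) (use diag pq in auto)
    finally show ?thesis using pq by simp
  qed
  ultimately show ?thesis
    using Hc X pq by (simp add: algebra_simps del: index_mult_mat(1))
qed

text \<open>The case distinction needed to see that the matrix unit \<open>(p, q)\<close> becomes an element of
  \<open>sp r\<close> after adding a suitable multiple of the conjugate matrix unit. The pairs \<open>(a, b)\<close> and
  \<open>(b, a)\<close> may coincide, and then only one entry is nonzero.\<close>

lemma index_sign_symmetric:
  "index_sign r i * (if i = a \<and> j = b then 1
      else if i = b \<and> j = a then index_sign r a * index_sign r b else 0) =
   index_sign r j * (if j = a \<and> i = b then 1
      else if j = b \<and> i = a then index_sign r a * index_sign r b else 0)"
proof -
  have cancel: "index_sign r x * (z * index_sign r x) = z" "index_sign r x * (index_sign r x * z) = z" for x z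
    by (simp_all add: index_sign_def)
  show ?thesis
  proof (cases "a = b")
    case True
    then show ?thesis by (cases "i = b"; cases "j = b") simp_all
  next
    case False
    then have "b \<noteq> a" by simp
    with False show ?thesis
      by (cases "i = a"; cases "i = b"; cases "j = a"; cases "j = b") (simp_all add: cancel)
  qed
qed

text \<open>A weight vector for \<open>row_weight r p - row_weight r q\<close>: the matrix unit \<open>(p, q)\<close> plus or minus
  the matrix unit at the conjugate indices of \<open>q\<close> and \<open>p\<close>, which has the same weight.\<close>

lemma root_vector_exists:
  assumes "p < 2 * r" "q < 2 * r"
  shows "\<exists>X \<in> sp r. X \<noteq> 0\<^sub>m (2 * r) (2 * r) \<and>
    (\<forall>H \<in> cartan r. H * X - X * H = pairing r (row_weight r p - row_weight r q) H \<cdot>\<^sub>m X)"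
proof -
  define X where "X = mat (2 * r) (2 * r) (\<lambda>(a, b). if a = p \<and> b = q then 1
    else if a = conj_index r q \<and> b = conj_index r p
    then index_sign r (conj_index r p) * index_sign r q else (0 :: complex))"
  have Xc: "X \<in> carrier_mat (2 * r) (2 * r)" by (simp add: X_def)
  have XI: "X \<in> sp r"
    unfolding sp_iff
  proof (intro conjI allI impI)
    fix i j assume ij: "i < 2 * r" "j < 2 * r"
    define p' where "p' = conj_index r p"
    have conj: "conj_index r a = b \<longleftrightarrow> a = conj_index r b"
      "conj_index r a = conj_index r b \<longleftrightarrow> a = b" if "a < 2 * r" "b < 2 * r" for a b
      using that by (metis conj_index_conj_index)+
    have entry: "X $$ (conj_index r a, b) = (if a = p' \<and> b = q then 1
        else if a = q \<and> b = p' then index_sign r p' * index_sign r q else 0)"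
      if "a < 2 * r" "b < 2 * r" for a b
      unfolding X_def p'_def using that by (simp only: index_mat conj_index_less prod.case conj
          conj_index_conj_index assms)
    show "index_sign r i * X $$ (conj_index r i, j) = index_sign r j * X $$ (conj_index r j, i)"
      unfolding entry[OF ij] entry[OF ij(2,1)]
      by (rule index_sign_symmetric)
  qed (rule Xc)
  have "X $$ (p, q) = 1" using assms by (simp add: X_def)
  then have X0: "X \<noteq> 0\<^sub>m (2 * r) (2 * r)" using assms by auto
  have "H * X - X * H = pairing r (row_weight r p - row_weight r q) H \<cdot>\<^sub>m X" if H: "H \<in> cartan r" for H
  proof (rule eq_matI)
    have Hc: "H \<in> carrier_mat (2 * r) (2 * r)" using H by (auto simp: cartan_def sp_def)
    show "dim_row (H * X - X * H) = dim_row (pairing r (row_weight r p - row_weight r q) H \<cdot>\<^sub>m X)"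
      and "dim_col (H * X - X * H) = dim_col (pairing r (row_weight r p - row_weight r q) H \<cdot>\<^sub>m X)"
      using Hc Xc by auto
    fix a b
    assume "a < dim_row (pairing r (row_weight r p - row_weight r q) H \<cdot>\<^sub>m X)"
      and "b < dim_col (pairing r (row_weight r p - row_weight r q) H \<cdot>\<^sub>m X)"
    then have ab: "a < 2 * r" "b < 2 * r" using Xc by auto
    have X_ab: "X $$ (a, b) = (if a = p \<and> b = q then 1
        else if a = conj_index r q \<and> b = conj_index r p
        then index_sign r (conj_index r p) * index_sign r q else 0)"
      using ab by (simp only: X_def index_mat prod.case)
    have "(H $$ (a, a) - H $$ (b, b)) * X $$ (a, b) = (H $$ (p, p) - H $$ (q, q)) * X $$ (a, b)"
    proof (cases "a = conj_index r q \<and> b = conj_index r p")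
      case True
      then show ?thesis
        by (simp only: cartan_conj_index[OF H] assms) simp
    next
      case False
      then show ?thesis unfolding X_ab by (simp only: if_False) simp
    qed
    then show "(H * X - X * H) $$ (a, b) =
        (pairing r (row_weight r p - row_weight r q) H \<cdot>\<^sub>m X) $$ (a, b)"
      using cartan_commutator_nth[OF H Xc ab] ab assms Xc
      by (simp add: pairing_diff pairing_row_weight[OF H])
  qed
  with XI X0 show ?thesis by blast
qed

lemma roots_eq:
  "roots r = {row_weight r p - row_weight r q | p q. p < 2 * r \<and> q < 2 * r} - {0}"
proof (intro equalityI subsetI)
  fix \<beta> assume "\<beta> \<in> roots r"
  then obtain X where \<beta>: "\<beta> \<in> cartan_dual r" "\<beta> \<noteq> 0" and X: "X \<in> sp r" "X \<noteq> 0\<^sub>m (2 * r) (2 * r)"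
    and eigen: "\<And>H. H \<in> cartan r \<Longrightarrow> H * X - X * H = pairing r \<beta> H \<cdot>\<^sub>m X"
    unfolding roots_def by blast
  have Xc: "X \<in> carrier_mat (2 * r) (2 * r)" using X by (simp add: sp_def)
  then obtain p q where pq: "p < 2 * r" "q < 2 * r" "X $$ (p, q) \<noteq> 0"
    using X(2) by (auto simp: mat_eq_iff)
  have "\<beta> = row_weight r p - row_weight r q"
  proof
    fix i
    show "\<beta> i = (row_weight r p - row_weight r q) i"
    proof (cases "i \<in> {1..r}")
      case True
      let ?H = "cartan_basis r i"
      have H: "?H \<in> cartan r" by (rule cartan_basis_in_cartan)
      have "(?H $$ (p, p) - ?H $$ (q, q)) * X $$ (p, q) = pairing r \<beta> ?H * X $$ (p, q)"
        using cartan_commutator_nth[OF H Xc pq(1,2)] eigen[OF H] pq Xc by simp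
      then show ?thesis
        using pq True pairing_cartan_basis[OF True] by (simp add: cartan_basis_def)
    next
      case False
      then show ?thesis
        using \<beta>(1) row_weight_in_cartan_dual[OF pq(1)] row_weight_in_cartan_dual[OF pq(2)]
        by (auto simp: cartan_dual_def)
    qed
  qed
  with pq \<beta>(2) show "\<beta> \<in> {row_weight r p - row_weight r q | p q. p < 2 * r \<and> q < 2 * r} - {0}"
    by blast
next
  fix \<beta> assume "\<beta> \<in> {row_weight r p - row_weight r q | p q. p < 2 * r \<and> q < 2 * r} - {0}"
  then obtain p q where pq: "p < 2 * r" "q < 2 * r" "\<beta> = row_weight r p - row_weight r q" "\<beta> \<noteq> 0"
    by blast
  have "\<beta> \<in> cartan_dual r"
    using row_weight_in_cartan_dual[OF pq(1)] row_weight_in_cartan_dual[OF pq(2)] pq(3)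
    by (auto simp: cartan_dual_def)
  then show "\<beta> \<in> roots r"
    using pq(4) root_vector_exists[OF pq(1,2)] by (simp add: roots_def flip: pq(3))
qed

section \<open>Positive roots and their half sum\<close>

lemma sum_eps: "(\<Sum>m = 1..k. eps i m) = (if 1 \<le> i \<and> i \<le> k then 1 else 0)"
  by (simp add: eps_def)

lemma Re_sum_root_combination_nonneg:
  assumes "1 \<le> k" "k \<le> r"
  shows "0 \<le> Re (\<Sum>i = 1..k. root_combination r c i)"
  by (simp only: sum_root_combination[OF assms]) simp

lemma eps_diff_in_positive_roots:
  assumes "1 \<le> i" "i < j" "j \<le> r"
  shows "eps i - eps j \<in> positive_roots r"
proof -
  have "i - 1 < r" "i - 1 + 1 = i" "j - 1 < r" "j - 1 + 1 = j" using assms by auto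
  then have "eps i - eps j = row_weight r (i - 1) - row_weight r (j - 1)"
    by (simp only: row_weight_def if_True)
  moreover have "(eps i - eps j) i \<noteq> 0" using assms by (simp add: eps_def)
  moreover have "i - 1 < 2 * r" "j - 1 < 2 * r" using assms by auto
  ultimately have "eps i - eps j \<in> roots r"
    unfolding roots_eq by (metis (mono_tags, lifting) DiffI mem_Collect_eq singletonD zero_fun_apply)
  moreover have "\<exists>c. eps i - eps j = root_combination r c"
  proof (subst root_combination_iff_partial_sums[where z = "\<lambda>m. of_bool (m = i) - of_bool (m = j)"])
    show "eps i - eps j \<in> cartan_dual r" using assms by (auto simp: cartan_dual_def eps_def)
    have "(\<Sum>m = 1..k. of_bool (m = i) - of_bool (m = j)) = (of_bool (i \<le> k) - of_bool (j \<le> k) :: int)" for k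
      using assms by (simp add: sum_subtractf of_bool_def)
    then show "(\<forall>k\<in>{1..r}. 0 \<le> (\<Sum>m = 1..k. of_bool (m = i) - of_bool (m = j) :: int)) \<and>
        even (\<Sum>m = 1..r. of_bool (m = i) - of_bool (m = j) :: int)"
      using assms by auto
  qed (use assms in \<open>auto simp: eps_def\<close>)
  ultimately show ?thesis by (simp add: positive_roots_def root_combination_def)
qed

lemma eps_add_in_positive_roots:
  assumes "1 \<le> i" "i \<le> j" "j \<le> r"
  shows "eps i + eps j \<in> positive_roots r"
proof -
  have "i - 1 < r" "i - 1 + 1 = i" "\<not> r + j - 1 < r" "r + j - 1 - r + 1 = j" using assms by auto
  then have "eps i + eps j = row_weight r (i - 1) - row_weight r (r + j - 1)"
    by (simp only: row_weight_def if_True if_False diff_minus_eq_add)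
  moreover have "(eps i + eps j) i \<noteq> 0" using assms by (simp add: eps_def)
  moreover have "i - 1 < 2 * r" "r + j - 1 < 2 * r" using assms by auto
  ultimately have "eps i + eps j \<in> roots r"
    unfolding roots_eq by (metis (mono_tags, lifting) DiffI mem_Collect_eq singletonD zero_fun_apply)
  moreover have "\<exists>c. eps i + eps j = root_combination r c"
  proof (subst root_combination_iff_partial_sums[where z = "\<lambda>m. of_bool (m = i) + of_bool (m = j)"])
    show "eps i + eps j \<in> cartan_dual r" using assms by (auto simp: cartan_dual_def eps_def)
    have "(\<Sum>m = 1..k. of_bool (m = i) + of_bool (m = j)) = (of_bool (i \<le> k) + of_bool (j \<le> k) :: int)" for k
      using assms by (simp add: sum.distrib of_bool_def)
    then show "(\<forall>k\<in>{1..r}. 0 \<le> (\<Sum>m = 1..k. of_bool (m = i) + of_bool (m = j) :: int)) \<and>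
        even (\<Sum>m = 1..r. of_bool (m = i) + of_bool (m = j) :: int)"
      using assms by auto
  qed (use assms in \<open>auto simp: eps_def\<close>)
  ultimately show ?thesis by (simp add: positive_roots_def root_combination_def)
qed

text \<open>The positive roots are \<open>\<epsilon>\<^sub>i - \<epsilon>\<^sub>j\<close> for \<open>i < j\<close> and
  \<open>\<epsilon>\<^sub>i + \<epsilon>\<^sub>j\<close> for \<open>i \<le> j\<close>; the case \<open>i = j\<close> gives the long roots. The remaining
  roots have a negative partial sum of coordinates.\<close>

lemma positive_roots_eq:
  "positive_roots r = (\<lambda>(i, j). eps i - eps j) ` (SIGMA i:{1..r}. {i<..r})
     \<union> (\<lambda>(i, j). eps i + eps j) ` (SIGMA i:{1..r}. {i..r})"
proof (intro equalityI subsetI)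
  fix \<beta> assume "\<beta> \<in> positive_roots r"
  then obtain c p q where \<beta>: "\<beta> = root_combination r c" "\<beta> \<noteq> 0"
      "\<beta> = row_weight r p - row_weight r q" "p < 2 * r" "q < 2 * r"
    unfolding positive_roots_def roots_eq root_combination_def by blast
  have nonneg: "0 \<le> Re (\<Sum>i = 1..k. \<beta> i)" if "1 \<le> k" "k \<le> r" for k
    using Re_sum_root_combination_nonneg[OF that] \<beta>(1) by simp
  have difference: "\<beta> \<in> (\<lambda>(i, j). eps i - eps j) ` (SIGMA i:{1..r}. {i<..r})"
    if "\<beta> = eps i - eps j" "1 \<le> i" "1 \<le> j" "i \<le> r" "j \<le> r" for i j
  proof -
    have "i \<noteq> j" using that \<beta>(2) by auto
    moreover have "\<not> j < i"
      using nonneg[of j] that by (auto simp: sum_subtractf sum_eps[unfolded One_nat_def])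
    ultimately show ?thesis using that by (intro image_eqI[of _ _ "(i, j)"]) auto
  qed
  consider "p < r" "q < r" | "p < r" "r \<le> q" | "r \<le> p" "q < r" | "r \<le> p" "r \<le> q"
    by linarith
  then show "\<beta> \<in> (\<lambda>(i, j). eps i - eps j) ` (SIGMA i:{1..r}. {i<..r})
     \<union> (\<lambda>(i, j). eps i + eps j) ` (SIGMA i:{1..r}. {i..r})"
  proof cases
    case 1
    then show ?thesis using difference[of "p + 1" "q + 1"] \<beta>(3) by (simp add: row_weight_def)
  next
    case 2
    define i j where "i = min (p + 1) (q - r + 1)" and "j = max (p + 1) (q - r + 1)"
    have "\<beta> = eps i + eps j"
      using 2 \<beta>(3) by (auto simp: row_weight_def i_def j_def min_def max_def add.commute)
    moreover have "(i, j) \<in> (SIGMA i:{1..r}. {i..r})"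
      using 2 \<beta>(4,5) by (auto simp: i_def j_def)
    ultimately show ?thesis by (intro UnI2 image_eqI[of _ _ "(i, j)"]) simp_all
  next
    case 3
    then have "(\<Sum>i = 1..r. \<beta> i) = - 2"
      using \<beta>(3-5) by (simp add: row_weight_def sum_subtractf sum_negf sum_eps[unfolded One_nat_def])
    then show ?thesis using nonneg[of r] 3 by simp
  next
    case 4
    then show ?thesis using difference[of "q - r + 1" "p - r + 1"] \<beta>(3-5) by (simp add: row_weight_def)
  qed
next
  fix \<beta> assume "\<beta> \<in> (\<lambda>(i, j). eps i - eps j) ` (SIGMA i:{1..r}. {i<..r})
     \<union> (\<lambda>(i, j). eps i + eps j) ` (SIGMA i:{1..r}. {i..r})"
  then show "\<beta> \<in> positive_roots r"
    by (auto intro: eps_diff_in_positive_roots eps_add_in_positive_roots)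
qed

lemma finite_positive_roots: "finite (positive_roots r)"
  unfolding positive_roots_eq by auto

lemma inj_on_eps_diff: "inj_on (\<lambda>(i, j). eps i - eps j) (SIGMA i:{1..r}. {i<..r})"
proof (rule inj_onI, clarify)
  fix i j i' j' :: nat
  assume *: "eps i - eps j = eps i' - eps j'" "i \<in> {1..r}" "j \<in> {i<..r}" "i' \<in> {1..r}" "j' \<in> {i'<..r}"
  have "(eps i - eps j) k = (eps i' - eps j') k" for k using *(1) by simp
  from this[of i] this[of j] show "i = i' \<and> j = j'"
    using *(2-) by (auto simp: eps_def split: if_splits)
qed

lemma inj_on_eps_add: "inj_on (\<lambda>(i, j). eps i + eps j) (SIGMA i:{1..r}. {i..r})"
proof (rule inj_onI, clarify)
  fix i j i' j' :: nat
  assume *: "eps i + eps j = eps i' + eps j'" "i \<in> {1..r}" "j \<in> {i..r}" "i' \<in> {1..r}" "j' \<in> {i'..r}"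
  have "(eps i + eps j) k = (eps i' + eps j') k" for k using *(1) by simp
  from this[of i] this[of j] this[of i'] this[of j'] show "i = i' \<and> j = j'"
    using *(2-) by (auto simp: eps_def split: if_splits)
qed

lemma eps_diff_neq_eps_add: "i \<noteq> j \<Longrightarrow> eps i - eps j \<noteq> eps i' + eps j'"
proof
  assume "i \<noteq> j" "eps i - eps j = eps i' + eps j'"
  then have "(eps i - eps j) j = (eps i' + eps j') j" by simp
  then have "Re ((eps i - eps j) j) = Re ((eps i' + eps j') j)" by (rule arg_cong)
  with \<open>i \<noteq> j\<close> show False by (auto simp: eps_def split: if_splits)
qed

text \<open>That is, \<open>\<rho> = (r, r - 1, \<dots>, 1)\<close>.\<close>

lemma half_sum_positive_roots_nth:
  "half_sum_positive_roots r k = (if k \<in> {1..r} then of_nat (r + 1 - k) else 0)"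
proof -
  have "(\<Sum>\<beta> \<in> positive_roots r. \<beta> k) =
     (\<Sum>\<beta> \<in> (\<lambda>(i, j). eps i - eps j) ` (SIGMA i:{1..r}. {i<..r}). \<beta> k)
     + (\<Sum>\<beta> \<in> (\<lambda>(i, j). eps i + eps j) ` (SIGMA i:{1..r}. {i..r}). \<beta> k)"
    unfolding positive_roots_eq
    by (rule sum.union_disjoint) (auto simp: eps_diff_neq_eps_add dest: eps_diff_neq_eps_add)
  also have "\<dots> = (\<Sum>i = 1..r. \<Sum>j\<in>{i<..r}. eps i k - eps j k) + (\<Sum>i = 1..r. \<Sum>j\<in>{i..r}. eps i k + eps j k)"
    unfolding sum.reindex[OF inj_on_eps_diff] sum.reindex[OF inj_on_eps_add]
    by (simp add: sum.Sigma case_prod_beta')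
  also have "(\<Sum>i = 1..r. \<Sum>j\<in>{i..r}. eps i k + eps j k) =
      (\<Sum>i = 1..r. 2 * eps i k + (\<Sum>j\<in>{i<..r}. eps i k + eps j k))"
    by (intro sum.cong refl, subst sum.head) auto
  also have "(\<Sum>i = 1..r. \<Sum>j\<in>{i<..r}. eps i k - eps j k) + \<dots> =
      (\<Sum>i = 1..r. 2 * (of_nat (r + 1 - i) * eps i k))"
    unfolding sum.distrib[symmetric]
    by (intro sum.cong refl)
      (auto simp: sum.distrib sum_subtractf algebra_simps of_nat_diff)
  also have "\<dots> = (\<Sum>i = 1..r. if i = k then 2 * of_nat (r + 1 - i) else 0)"
    by (intro sum.cong) (auto simp: eps_def)
  also have "\<dots> = (if k \<in> {1..r} then 2 * of_nat (r + 1 - k) else 0)"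
    by simp
  finally show ?thesis by (simp add: half_sum_positive_roots_def)
qed

section \<open>Positivity of the partition function\<close>

lemma simple_root_positive:
  assumes "i \<in> {1..r}"
  shows "simple_root r i \<in> positive_roots r"
  using assms eps_diff_in_positive_roots[of i "i + 1" r] eps_add_in_positive_roots[of r r r]
  by (auto simp: simple_root_def)

text \<open>The height of a weight, except that the coefficient of the long simple root counts twice: by
  \<open>sum_root_combination\<close>, it is the sum of the partial sums of the coordinates.\<close>

definition height :: "nat \<Rightarrow> weight \<Rightarrow> real" where
  "height r \<xi> = Re (\<Sum>k = 1..r. \<Sum>i = 1..k. \<xi> i)"

lemma height_add: "height r (\<xi> + \<eta>) = height r \<xi> + height r \<eta>"
  by (simp add: height_def sum.distrib)

lemma height_positive_root:
  assumes "\<beta> \<in> positive_roots r"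
  shows "1 \<le> height r \<beta>"
proof -
  obtain c where c: "\<beta> = root_combination r c" "\<beta> \<noteq> 0"
    using assms unfolding positive_roots_def roots_def root_combination_def by blast
  have "\<exists>k\<in>{1..r}. c k \<noteq> 0"
  proof (rule ccontr)
    assume "\<not> (\<exists>k\<in>{1..r}. c k \<noteq> 0)"
    then have "\<beta> = 0" unfolding c(1) root_combination_def by (intro sum.neutral) auto
    with c(2) show False by simp
  qed
  then obtain k where k: "k \<in> {1..r}" "c k \<noteq> 0" by blast
  have "1 \<le> Re (\<Sum>i = 1..k. \<beta> i)"
    using k by (auto simp add: c(1) sum_root_combination[unfolded One_nat_def])
  also have "\<dots> \<le> (\<Sum>k = 1..r. Re (\<Sum>i = 1..k. \<beta> i))"
    using k Re_sum_root_combination_nonneg c(1)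
    by (intro member_le_sum[of k "{1..r}" "\<lambda>k. Re (\<Sum>i = 1..k. \<beta> i)"]) auto
  finally show ?thesis by (simp add: height_def)
qed

lemma finite_bounded_multisets:
  assumes "finite A"
  shows "finite {M. set_mset M \<subseteq> A \<and> size M \<le> n}"
proof -
  have "{M. set_mset M \<subseteq> A \<and> size M \<le> n} \<subseteq> mset ` {xs. set xs \<subseteq> A \<and> length xs \<le> n}"
  proof
    fix M assume "M \<in> {M. set_mset M \<subseteq> A \<and> size M \<le> n}"
    moreover obtain xs where "mset xs = M" by (metis ex_mset)
    ultimately show "M \<in> mset ` {xs. set xs \<subseteq> A \<and> length xs \<le> n}" by auto
  qed
  then show ?thesis using finite_lists_length_le[OF assms] finite_surj by blast
qed

text \<open>Since every positive root has height at least 1, the height of \<open>\<xi>\<close> bounds the number of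
  summands. Finiteness matters because the cardinality of an infinite set is 0.\<close>

lemma finite_kostant_partitions:
  "finite {M. set_mset M \<subseteq> positive_roots r \<and> \<Sum>\<^sub># M = \<xi>}"
proof (rule finite_subset[OF _ finite_bounded_multisets[OF finite_positive_roots]])
  have "real (size M) \<le> height r (\<Sum>\<^sub># M)" if "set_mset M \<subseteq> positive_roots r" for M
    using that
  proof (induction M)
    case (add \<beta> M)
    then have "1 \<le> height r \<beta>" by (intro height_positive_root) auto
    moreover have "real (size M) \<le> height r (\<Sum>\<^sub># M)" using add by auto
    ultimately show ?case by (simp only: sum_mset.add_mset height_add size_add_mset)
  qed (simp add: height_def)
  then show "{M. set_mset M \<subseteq> positive_roots r \<and> \<Sum>\<^sub># M = \<xi>}
      \<subseteq> {M. set_mset M \<subseteq> positive_roots r \<and> size M \<le> nat \<lfloor>height r \<xi>\<rfloor>}"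
    using le_nat_floor by blast
qed

lemma kostant_partition_pos_iff:
  "0 < kostant_partition r \<xi> \<longleftrightarrow> (\<exists>c. \<xi> = root_combination r c)"
proof
  assume "0 < kostant_partition r \<xi>"
  then obtain M where M: "set_mset M \<subseteq> positive_roots r" "\<Sum>\<^sub># M = \<xi>"
    unfolding kostant_partition_def by (metis (mono_tags, lifting) card.empty empty_Collect_eq less_irrefl)
  have "\<exists>c. \<Sum>\<^sub># M = root_combination r c" using M(1)
  proof (induction M)
    case empty
    show ?case using root_combination_0[of r] by (metis sum_mset.empty)
  next
    case (add \<beta> M)
    then obtain c d where "\<Sum>\<^sub># M = root_combination r c" "\<beta> = root_combination r d"
      by (auto simp: positive_roots_def root_combination_def)
    then have "\<Sum>\<^sub># (add_mset \<beta> M) = root_combination r (\<lambda>i. d i + c i)"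
      by (simp add: root_combination_add)
    then show ?case by blast
  qed
  with M(2) show "\<exists>c. \<xi> = root_combination r c" by simp
next
  assume "\<exists>c. \<xi> = root_combination r c"
  then obtain c where c: "\<xi> = root_combination r c" by blast
  define M where "M = (\<Sum>i = 1..r. replicate_mset (c i) (simple_root r i))"
  have mult: "\<Sum>\<^sub># (replicate_mset n \<beta>) = (\<lambda>k. of_nat n * \<beta> k)" for n and \<beta> :: weight
    by (induction n) (auto simp: fun_eq_iff algebra_simps)
  have sum: "\<Sum>\<^sub># (\<Sum>i\<in>I. N i) = (\<Sum>i\<in>I. \<Sum>\<^sub># (N i))" if "finite I" for I :: "nat set" and N :: "nat \<Rightarrow> weight multiset"
    using that by induction auto
  have "\<Sum>\<^sub># M = \<xi>"
    by (simp only: M_def c root_combination_def sum[OF finite_atLeastAtMost] mult)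
  moreover have "set_mset M \<subseteq> positive_roots r"
    using simple_root_positive by (auto simp: M_def set_mset_sum split: if_splits)
  ultimately have "{M. set_mset M \<subseteq> positive_roots r \<and> \<Sum>\<^sub># M = \<xi>} \<noteq> {}" by blast
  then show "0 < kostant_partition r \<xi>"
    using finite_kostant_partitions[of r \<xi>] by (simp add: kostant_partition_def card_gt_0_iff)
qed

section \<open>Weyl group elements as signed permutations\<close>

text \<open>The permutation \<open>p\<close> of the coordinates followed by multiplication with the signs \<open>s\<close>,
  restricted to the dual of the Cartan subalgebra so that it is an element of \<open>BijGroup\<close>. As it acts by
  precomposition with \<open>p\<close>, composition of actions reverses the order of the permutations.\<close>

definition signed_perm_action :: "nat \<Rightarrow> (nat \<Rightarrow> complex) \<Rightarrow> (nat \<Rightarrow> nat) \<Rightarrow> weight \<Rightarrow> weight" where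
  "signed_perm_action r s p = (\<lambda>\<xi> \<in> cartan_dual r. \<lambda>k. s k * \<xi> (p k))"

abbreviation perm_action :: "nat \<Rightarrow> (nat \<Rightarrow> nat) \<Rightarrow> weight \<Rightarrow> weight" where
  "perm_action r \<equiv> signed_perm_action r (\<lambda>_. 1)"

lemma signed_perm_in_cartan_dual:
  assumes "p permutes {1..r}" "\<xi> \<in> cartan_dual r"
  shows "(\<lambda>k. s k * \<xi> (p k)) \<in> cartan_dual r"
  using assms permutes_not_in[OF assms(1)] by (auto simp: cartan_dual_def)

lemma signed_perm_action_in_Bij:
  assumes p: "p permutes {1..r}" and s: "\<And>k. s k \<in> {1, - 1}"
  shows "signed_perm_action r s p \<in> Bij (cartan_dual r)"
proof -
  have ss: "s k * s k = 1" for k using s[of k] by auto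
  let ?q = "inv_into UNIV p"
  have q: "?q permutes {1..r}" using p by (rule permutes_inv)
  have "bij_betw (signed_perm_action r s p) (cartan_dual r) (cartan_dual r)"
  proof (rule bij_betw_byWitness[where f' = "\<lambda>\<xi> k. s (?q k) * \<xi> (?q k)"])
    show "\<forall>\<xi>\<in>cartan_dual r. (\<lambda>k. s (?q k) * signed_perm_action r s p \<xi> (?q k)) = \<xi>"
      using ss by (simp add: signed_perm_action_def permutes_inverses[OF p] flip: mult.assoc)
    show "\<forall>\<xi>\<in>cartan_dual r. signed_perm_action r s p (\<lambda>k. s (?q k) * \<xi> (?q k)) = \<xi>"
      using ss signed_perm_in_cartan_dual[OF q, where s = "\<lambda>k. s (?q k)"]
      by (simp add: signed_perm_action_def permutes_inverses[OF p] flip: mult.assoc)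
    show "signed_perm_action r s p ` cartan_dual r \<subseteq> cartan_dual r"
      using signed_perm_in_cartan_dual[OF p] by (auto simp: signed_perm_action_def)
    show "(\<lambda>\<xi> k. s (?q k) * \<xi> (?q k)) ` cartan_dual r \<subseteq> cartan_dual r"
      using signed_perm_in_cartan_dual[OF q, where s = "\<lambda>k. s (?q k)"] by auto
  qed
  then show ?thesis by (simp add: Bij_def signed_perm_action_def)
qed

lemma compose_signed_perm_action:
  assumes "q permutes {1..r}"
  shows "compose (cartan_dual r) (signed_perm_action r s p) (signed_perm_action r t q) =
    signed_perm_action r (\<lambda>k. s k * t (p k)) (q \<circ> p)"
  using signed_perm_in_cartan_dual[OF assms]
  by (auto simp: compose_def signed_perm_action_def fun_eq_iff restrict_def mult.assoc)

lemma mult_signed_perm_action: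
  assumes "p permutes {1..r}" "q permutes {1..r}" "\<And>k. s k \<in> {1, - 1}" "\<And>k. t k \<in> {1, - 1}"
  shows "signed_perm_action r s p \<otimes>\<^bsub>BijGroup (cartan_dual r)\<^esub> signed_perm_action r t q =
    signed_perm_action r (\<lambda>k. s k * t (p k)) (q \<circ> p)"
  using assms by (simp add: BijGroup_def signed_perm_action_in_Bij compose_signed_perm_action)

lemma weight_form_add_right: "weight_form r \<xi> (\<eta> + \<zeta>) = weight_form r \<xi> \<eta> + weight_form r \<xi> \<zeta>"
  by (simp add: weight_form_def sum.distrib algebra_simps)

lemma weight_form_diff_right: "weight_form r \<xi> (\<eta> - \<zeta>) = weight_form r \<xi> \<eta> - weight_form r \<xi> \<zeta>"
  by (simp add: weight_form_def sum_subtractf algebra_simps)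

lemma weight_form_eps:
  assumes "i \<in> {1..r}"
  shows "weight_form r \<xi> (eps i) = \<xi> i"
proof -
  have "weight_form r \<xi> (eps i) = (\<Sum>j = 1..r. if j = i then \<xi> j else 0)"
    unfolding weight_form_def by (intro sum.cong) (auto simp: eps_def)
  then show ?thesis using assms by simp
qed

lemma simple_reflection_short:
  assumes "1 \<le> i" "i < r"
  shows "simple_reflection r i = perm_action r (transpose i (i + 1))"
proof -
  have root: "simple_root r i = eps i - eps (i + 1)"
    using assms by (simp add: simple_root_def)
  have form: "weight_form r \<xi> (simple_root r i) = \<xi> i - \<xi> (i + 1)" for \<xi>
    unfolding root weight_form_diff_right using assms by (simp add: weight_form_eps)
  have norm: "simple_root r i i - simple_root r i (i + 1) = 2"
    by (simp add: root eps_def)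
  show ?thesis
    unfolding simple_reflection_def reflection_def signed_perm_action_def form norm
    by (intro restrict_ext ext) (auto simp: root eps_def transpose_def diff_divide_distrib)
qed

lemma simple_reflection_long:
  assumes "1 \<le> r"
  shows "simple_reflection r r = signed_perm_action r (\<lambda>k. if k = r then - 1 else 1) id"
proof -
  have root: "simple_root r r = eps r + eps r"
    by (simp add: simple_root_def)
  have form: "weight_form r \<xi> (simple_root r r) = \<xi> r + \<xi> r" for \<xi>
    unfolding root weight_form_add_right using assms by (simp add: weight_form_eps)
  have norm: "simple_root r r r + simple_root r r r = 4"
    unfolding root by (simp add: eps_def)
  show ?thesis
    unfolding simple_reflection_def reflection_def signed_perm_action_def form norm
    by (intro restrict_ext ext) (auto simp: root[unfolded fun_eq_iff] eps_def)
qed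

lemma simple_reflection_signed_perm:
  assumes "i \<in> {1..r}"
  obtains s p where "p permutes {1..r}" "\<And>k. s k \<in> {1, - 1}" "simple_reflection r i = signed_perm_action r s p"
    "p \<circ> p = id" "\<And>k. s k * s (p k) = 1"
proof (cases "i = r")
  case True
  show ?thesis
  proof (rule that)
    show "simple_reflection r i = signed_perm_action r (\<lambda>k. if k = r then - 1 else 1) id"
      using True assms simple_reflection_long[of r] by simp
  qed (auto simp: permutes_id)
next
  case False
  then have i: "1 \<le> i" "i < r" using assms by auto
  show ?thesis
  proof (rule that)
    show "simple_reflection r i = perm_action r (transpose i (i + 1))"
      by (rule simple_reflection_short[OF i])
    show "transpose i (i + 1) permutes {1..r}"
      using i by (intro permutes_swap_id) auto
  qed auto
qed

text \<open>Only this inclusion is needed for signed permutations; unsigned permutations are shown to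
  lie in the Weyl group below.\<close>

lemma weyl_group_signed_perm:
  assumes "\<sigma> \<in> weyl_group r"
  shows "\<exists>s p. p permutes {1..r} \<and> (\<forall>k. s k \<in> {1, - 1}) \<and> \<sigma> = signed_perm_action r s p"
  using assms unfolding weyl_group_def
proof (induction rule: generate.induct)
  case one
  have "\<one>\<^bsub>BijGroup (cartan_dual r)\<^esub> = perm_action r id"
    by (simp add: BijGroup_def signed_perm_action_def)
  then show ?case
    using permutes_id by (intro exI[of _ "\<lambda>_. 1 :: complex"] exI[of _ "id :: nat \<Rightarrow> nat"]) (simp add: id_def)
next
  case (incl \<sigma>)
  then show ?case using simple_reflection_signed_perm by (metis imageE)
next
  case (inv \<sigma>)
  interpret group "BijGroup (cartan_dual r)" by (rule group_BijGroup)
  obtain i where i: "i \<in> {1..r}" "\<sigma> = simple_reflection r i" using inv by blast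
  then obtain s p where sp: "p permutes {1..r}" "\<And>k. s k \<in> {1, - 1}" "\<sigma> = signed_perm_action r s p"
    "p \<circ> p = id" "\<And>k. s k * s (p k) = 1"
    using simple_reflection_signed_perm by metis
  have "\<sigma> \<in> carrier (BijGroup (cartan_dual r))"
    using signed_perm_action_in_Bij[OF sp(1,2)] sp(3) by (simp add: BijGroup_def)
  moreover have "\<sigma> \<otimes>\<^bsub>BijGroup (cartan_dual r)\<^esub> \<sigma> = \<one>\<^bsub>BijGroup (cartan_dual r)\<^esub>"
    unfolding sp(3) mult_signed_perm_action[OF sp(1,1,2,2)] sp(4,5)
    by (simp add: BijGroup_def signed_perm_action_def)
  ultimately have "inv\<^bsub>BijGroup (cartan_dual r)\<^esub> \<sigma> = \<sigma>"
    by (metis inv_equality)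
  with sp show ?case by metis
next
  case (eng \<sigma> \<tau>)
  then obtain s p t q where
    sp: "p permutes {1..r}" "\<And>k. s k \<in> {1, - 1}" "\<sigma> = signed_perm_action r s p" and
    tq: "q permutes {1..r}" "\<And>k. t k \<in> {1, - 1}" "\<tau> = signed_perm_action r t q"
    by blast
  have "s k * t (p k) \<in> {1, - 1}" for k using sp(2)[of k] tq(2)[of "p k"] by auto
  moreover have "q \<circ> p permutes {1..r}" using sp(1) tq(1) by (rule permutes_compose)
  ultimately show ?case
    unfolding sp(3) tq(3) mult_signed_perm_action[OF sp(1) tq(1) sp(2) tq(2)]
    by (intro exI[of _ "\<lambda>k. s k * t (p k)"] exI[of _ "q \<circ> p"])
      (simp add: comp_def)
qed

lemma perm_action_mult_in_weyl_group:
  assumes "p permutes {1..r}" "q permutes {1..r}"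
    "perm_action r p \<in> weyl_group r" "perm_action r q \<in> weyl_group r"
  shows "perm_action r (q \<circ> p) \<in> weyl_group r"
proof -
  have "perm_action r p \<otimes>\<^bsub>BijGroup (cartan_dual r)\<^esub> perm_action r q \<in> weyl_group r"
    using assms(3,4) unfolding weyl_group_def by (rule generate.eng)
  then show ?thesis using mult_signed_perm_action[OF assms(1,2)] by simp
qed

lemma transposition_in_weyl_group:
  assumes "1 \<le> i" "i < j" "j \<le> r"
  shows "perm_action r (transpose i j) \<in> weyl_group r"
  using assms(2,1,3)
proof (induction j)
  case (Suc j)
  have adjacent: "perm_action r (transpose j (Suc j)) \<in> weyl_group r" if "1 \<le> j"
  proof -
    have "simple_reflection r j \<in> weyl_group r"
      unfolding weyl_group_def using that Suc.prems by (intro generate.incl) auto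
    then show ?thesis using simple_reflection_short[of j r] that Suc.prems by simp
  qed
  show ?case
  proof (cases "i = j")
    case True
    then show ?thesis using adjacent Suc.prems by simp
  next
    case False
    then have ij: "i < j" using Suc.prems by simp
    \<comment> \<open>conjugating by an adjacent transposition moves one end by one step\<close>
    let ?a = "transpose j (Suc j)" and ?t = "transpose i j"
    have perms: "?a permutes {1..r}" "?t permutes {1..r}"
      using Suc.prems ij by (auto intro: permutes_swap_id)
    have "perm_action r ?t \<in> weyl_group r" using Suc ij by simp
    then have "perm_action r (?a \<circ> (?t \<circ> ?a)) \<in> weyl_group r"
      using adjacent Suc.prems perms
      by (intro perm_action_mult_in_weyl_group permutes_compose) auto
    also have "?a \<circ> (?t \<circ> ?a) = transpose i (Suc j)"
      using ij by (auto simp: fun_eq_iff transpose_def)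
    finally show ?thesis .
  qed
qed simp

lemma perm_action_in_weyl_group:
  assumes "p permutes {1..r}"
  shows "perm_action r p \<in> weyl_group r"
  using assms finite_atLeastAtMost
proof (induction rule: permutes_induct)
  case id
  have "\<one>\<^bsub>BijGroup (cartan_dual r)\<^esub> \<in> weyl_group r"
    unfolding weyl_group_def by (rule generate.one)
  moreover have "\<one>\<^bsub>BijGroup (cartan_dual r)\<^esub> = perm_action r id"
    by (simp add: BijGroup_def signed_perm_action_def)
  ultimately show ?case by (simp add: id_def)
next
  case (swap a b p)
  have "perm_action r (transpose a b) \<in> weyl_group r"
    using transposition_in_weyl_group[of a b r] transposition_in_weyl_group[of b a r] swap
    by (metis atLeastAtMost_iff linorder_neqE_nat transpose_commute)
  with swap show ?case
    by (intro perm_action_mult_in_weyl_group) (auto intro: permutes_swap_id)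
qed

lemma perm_action_inj:
  assumes "p permutes {1..r}" "q permutes {1..r}" "perm_action r p = perm_action r q"
  shows "p = q"
proof
  fix k
  show "p k = q k"
  proof (cases "k \<in> {1..r}")
    case True
    then have "p k \<in> {1..r}" using assms(1) by (simp only: permutes_in_image)
    then have "eps (p k) \<in> cartan_dual r" by (auto simp: cartan_dual_def eps_def)
    then have "eps (p k) (p k) = eps (p k) (q k)"
      using fun_cong[OF fun_cong[OF assms(3)], of "eps (p k)" k] by (simp add: signed_perm_action_def)
    then show ?thesis by (simp add: eps_def split: if_splits)
  next
    case False
    then show ?thesis using assms by (simp add: permutes_not_in)
  qed
qed

section \<open>Counting orderings with nonnegative partial sums\<close>

text \<open>The partial sums of \<open>v - (n, n - 1, \<dots>, 1)\<close>, started from the value \<open>s\<close>, stay nonnegative,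
  where \<open>n\<close> is the length of \<open>v\<close>. The entry subtracted is the number of entries of \<open>v\<close> from the
  current one to the end, so the recursion needs no further parameter.\<close>

fun dominates :: "int \<Rightarrow> int list \<Rightarrow> bool" where
  "dominates s [] \<longleftrightarrow> True"
| "dominates s (v # vs) \<longleftrightarrow>
     0 \<le> s + v - int (Suc (length vs)) \<and> dominates (s + v - int (Suc (length vs))) vs"

lemma dominates_iff_partial_sums:
  "dominates s vs \<longleftrightarrow>
    (\<forall>k\<in>{1..length vs}. 0 \<le> s + (\<Sum>i = 1..k. vs ! (i - 1) - int (length vs + 1 - i)))"
proof (induction vs arbitrary: s)
  case (Cons v vs)
  let ?s = "s + v - int (Suc (length vs))"
  have shift: "s + (\<Sum>i = 1..Suc k. (v # vs) ! (i - 1) - int (length (v # vs) + 1 - i)) =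
      ?s + (\<Sum>i = 1..k. vs ! (i - 1) - int (length vs + 1 - i))" for k
  proof -
    have "(\<Sum>i = 1..Suc k. (v # vs) ! (i - 1) - int (length (v # vs) + 1 - i)) =
      (v - int (Suc (length vs))) + (\<Sum>i = Suc 1..Suc k. (v # vs) ! (i - 1) - int (length (v # vs) + 1 - i))"
      by (subst sum.atLeast_Suc_atMost) simp_all
    also have "(\<Sum>i = Suc 1..Suc k. (v # vs) ! (i - 1) - int (length (v # vs) + 1 - i)) =
       (\<Sum>i = 1..k. vs ! (i - 1) - int (length vs + 1 - i))"
      unfolding sum.shift_bounds_cl_Suc_ivl by (intro sum.cong) (auto simp: nth_Cons')
    finally show ?thesis by simp
  qed
  have range: "{1..length (v # vs)} = insert (Suc 0) (Suc ` {1..length vs})"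
    by (auto simp: image_iff)
  have "(\<forall>k\<in>{1..length (v # vs)}. 0 \<le> s + (\<Sum>i = 1..k. (v # vs) ! (i - 1) - int (length (v # vs) + 1 - i)))
     \<longleftrightarrow> 0 \<le> s + (\<Sum>i = 1..Suc 0. (v # vs) ! (i - 1) - int (length (v # vs) + 1 - i)) \<and>
        (\<forall>k\<in>{1..length vs}. 0 \<le> s + (\<Sum>i = 1..Suc k. (v # vs) ! (i - 1) - int (length (v # vs) + 1 - i)))"
    unfolding range by (simp only: ball_simps)
  also have "\<dots> \<longleftrightarrow> 0 \<le> ?s \<and> (\<forall>k\<in>{1..length vs}. 0 \<le> ?s + (\<Sum>i = 1..k. vs ! (i - 1) - int (length vs + 1 - i)))"
    unfolding shift by simp
  finally show ?case using Cons.IH[of ?s] by simp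
qed simp

text \<open>The coordinates \<open>(r + 1, r - 1, \<dots>, 3, 2, 2)\<close> of \<open>\<alpha>\<^sub>1 + \<dots> + \<alpha>\<^sub>r + \<rho>\<close>.
  The last two are equal, so arrangements are counted as lists of indices, not of values.\<close>

definition shifted_entry :: "nat \<Rightarrow> nat \<Rightarrow> int" where
  "shifted_entry r i = (if i = 1 then int r + 1 else max (int r + 1 - int i) 2)"

text \<open>The admissible orders of the coordinates numbered \<open>j, \<dots>, r\<close> in the last \<open>r + 1 - j\<close>
  positions, given that the partial sum over the earlier positions is 1.\<close>

definition arrangements :: "nat \<Rightarrow> nat \<Rightarrow> nat list set" where
  "arrangements r j = {xs \<in> permutations_of_set {j..r}. dominates 1 (map (shifted_entry r) xs)}"

lemma length_permutation:
  assumes "xs \<in> permutations_of_set {j..r}"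
  shows "length xs = r + 1 - j"
  using length_finite_permutations_of_set[OF assms] by simp

lemma permutations_of_set_ConsD:
  assumes "x # xs \<in> permutations_of_set A"
  shows "x \<in> A" "xs \<in> permutations_of_set (A - {x})"
  using assms by (auto simp: permutations_of_set_def)

lemma dominates_short:
  assumes "\<forall>v\<in>set vs. 2 \<le> v" "length vs \<le> 3"
  shows "dominates 1 vs"
proof -
  have "length vs = 0 \<or> length vs = 1 \<or> length vs = 2 \<or> length vs = 3"
    using assms(2) by linarith
  then show ?thesis
    using assms(1) by (auto simp: length_Suc_conv numeral_2_eq_2 numeral_3_eq_3)
qed

lemma arrangements_short:
  assumes "2 \<le> j" "r \<le> j + 2"
  shows "arrangements r j = permutations_of_set {j..r}"
proof -
  have "dominates 1 (map (shifted_entry r) xs)" if "xs \<in> permutations_of_set {j..r}" for xs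
  proof (rule dominates_short)
    show "length (map (shifted_entry r) xs) \<le> 3"
      using length_permutation[OF that] assms by simp
    show "\<forall>v\<in>set (map (shifted_entry r) xs). 2 \<le> v"
      using permutations_of_setD(1)[OF that] assms by (auto simp: shifted_entry_def)
  qed
  then show ?thesis by (auto simp: arrangements_def)
qed

text \<open>With \<open>r - j \<ge> 3\<close>, the next entry must be at least \<open>r - j \<ge> 3\<close>, so it has index \<open>j\<close> or
  \<open>j + 1\<close>. Index \<open>j\<close> leaves the partial sum at 1. Index \<open>j + 1\<close> lowers it to 0; then index \<open>j\<close> is
  forced and brings it back to 1.\<close>

lemma arrangements_step:
  assumes "2 \<le> j" "j + 3 \<le> r"
  shows "arrangements r j = (#) j ` arrangements r (j + 1) \<union> (\<lambda>xs. (j + 1) # j # xs) ` arrangements r (j + 2)"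
proof (intro equalityI subsetI)
  fix ys assume ys: "ys \<in> arrangements r j"
  then have perm: "ys \<in> permutations_of_set {j..r}" and dom: "dominates 1 (map (shifted_entry r) ys)"
    by (auto simp: arrangements_def)
  have len: "length ys = r + 1 - j" by (rule length_permutation[OF perm])
  with assms obtain x xs where x: "ys = x # xs" by (cases ys) auto
  have xin: "x \<in> {j..r}" and xs: "xs \<in> permutations_of_set ({j..r} - {x})"
    using permutations_of_set_ConsD[of x xs "{j..r}"] perm x by auto
  have lenxs: "length xs = r - j" using len x by simp
  have "x \<le> j + 1"
    using dom xin lenxs assms by (auto simp: x shifted_entry_def max_def split: if_splits)
  with xin consider "x = j" | "x = j + 1" by fastforce
  then show "ys \<in> (#) j ` arrangements r (j + 1) \<union> (\<lambda>xs. (j + 1) # j # xs) ` arrangements r (j + 2)"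
  proof cases
    case 1
    have "{j..r} - {x} = {j + 1..r}" using 1 by auto
    then have "xs \<in> arrangements r (j + 1)"
      using xs dom 1 lenxs assms by (simp add: arrangements_def x shifted_entry_def max_def of_nat_diff)
    with 1 x show ?thesis by blast
  next
    case 2
    obtain y zs where y: "xs = y # zs" using lenxs assms by (cases xs) auto
    have yin: "y \<in> {j..r} - {x}" and zs: "zs \<in> permutations_of_set ({j..r} - {x} - {y})"
      using permutations_of_set_ConsD[of y zs "{j..r} - {x}"] xs y by auto
    have lenzs: "length zs = r - j - 1" using lenxs y by simp
    have "y = j"
      using dom yin lenzs assms 2 by (auto simp: x y shifted_entry_def max_def split: if_splits)
    moreover have "{j..r} - {x} - {j} = {j + 2..r}" using 2 by auto
    ultimately have "zs \<in> arrangements r (j + 2)"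
      using zs dom 2 lenzs assms by (simp add: arrangements_def x y shifted_entry_def max_def of_nat_diff)
    with 2 x y \<open>y = j\<close> show ?thesis by blast
  qed
next
  fix ys assume "ys \<in> (#) j ` arrangements r (j + 1) \<union> (\<lambda>xs. (j + 1) # j # xs) ` arrangements r (j + 2)"
  then consider xs where "ys = j # xs" "xs \<in> arrangements r (j + 1)"
    | zs where "ys = (j + 1) # j # zs" "zs \<in> arrangements r (j + 2)" by blast
  then show "ys \<in> arrangements r j"
  proof cases
    case 1
    have "{j..r} = insert j {j + 1..r}" using assms by auto
    moreover have "length xs = r - j"
      using 1 length_permutation[of xs "j + 1" r] by (simp add: arrangements_def)
    ultimately show ?thesis
      using 1 assms by (auto simp: arrangements_def permutations_of_set_def shifted_entry_def max_def of_nat_diff)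
  next
    case 2
    have "{j..r} = insert (j + 1) (insert j {j + 2..r})" using assms by auto
    moreover have "length zs = r - j - 1"
      using 2 length_permutation[of zs "j + 2" r] by (simp add: arrangements_def)
    ultimately show ?thesis
      using 2 assms by (auto simp: arrangements_def permutations_of_set_def shifted_entry_def max_def of_nat_diff)
  qed
qed

lemma finite_arrangements: "finite (arrangements r j)"
  by (simp add: arrangements_def)

lemma card_arrangements:
  assumes "2 \<le> j" "j < r"
  shows "card (arrangements r j) = F_tilde (r - j)"
proof -
  define n where "n = r - j"
  from n_def assms have "card (arrangements r j) = F_tilde n"
  proof (induction n arbitrary: j rule: F_tilde.induct)
    case 1
    then show ?case by simp
  next
    case 2
    then have "r = Suc j" by simp
    with 2 show ?case by (simp add: arrangements_short)
  next
    case 3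
    then have "r = Suc (Suc j)" by simp
    with 3 show ?case by (simp add: arrangements_short fact_numeral numeral_3_eq_3)
  next
    case (4 n)
    then have diffs: "r - (j + 1) = Suc (Suc n)" "r - (j + 2) = Suc n" by simp_all
    have "card (arrangements r j) =
        card ((#) j ` arrangements r (j + 1)) + card ((\<lambda>xs. (j + 1) # j # xs) ` arrangements r (j + 2))"
      using 4 by (subst arrangements_step) (auto intro!: card_Un_disjoint simp: finite_arrangements)
    also have "\<dots> = card (arrangements r (j + 1)) + card (arrangements r (j + 2))"
      by (simp add: card_image inj_on_def)
    also have "\<dots> = F_tilde (Suc (Suc n)) + F_tilde (Suc n)"
      using "4.IH"(1)[of "j + 1"] "4.IH"(2)[of "j + 2"] diffs "4.prems"(2) by simp
    finally show ?case by simp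
  qed
  then show ?thesis by (simp add: n_def)
qed

lemma card_dominating_permutations:
  assumes "3 \<le> r"
  shows "card {xs \<in> permutations_of_set {1..r}. dominates 0 (map (shifted_entry r) xs)} = F_tilde (r - 2)"
proof -
  have "{xs \<in> permutations_of_set {1..r}. dominates 0 (map (shifted_entry r) xs)} = (#) 1 ` arrangements r 2"
  proof (intro equalityI subsetI)
    fix ys assume "ys \<in> {xs \<in> permutations_of_set {1..r}. dominates 0 (map (shifted_entry r) xs)}"
    then have perm: "ys \<in> permutations_of_set {1..r}" and dom: "dominates 0 (map (shifted_entry r) ys)"
      by auto
    have len: "length ys = r" using length_permutation[OF perm] by simp
    with assms obtain x xs where x: "ys = x # xs" by (cases ys) auto
    have xin: "x \<in> {1..r}" and xs: "xs \<in> permutations_of_set ({1..r} - {x})"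
      using permutations_of_set_ConsD[of x xs "{1..r}"] perm x by auto
    have lenxs: "length xs = r - 1" using len x by simp
    \<comment> \<open>the first entry must be at least \<open>r\<close>, and only \<open>r + 1\<close> is\<close>
    have x1: "x = 1"
      using dom xin lenxs assms by (auto simp: x shifted_entry_def max_def split: if_splits)
    moreover have "{1..r} - {1} = {2..r}" by auto
    ultimately have "xs \<in> arrangements r 2"
      using xs dom lenxs assms by (simp add: arrangements_def x shifted_entry_def of_nat_diff)
    with x x1 show "ys \<in> (#) 1 ` arrangements r 2" by blast
  next
    fix ys assume "ys \<in> (#) 1 ` arrangements r 2"
    then obtain xs where xs: "ys = 1 # xs" "xs \<in> arrangements r 2" by blast
    have "{1..r} = insert 1 {2..r}" using assms by auto
    moreover have "length xs = r - 1"
      using xs length_permutation[of xs 2 r] by (simp add: arrangements_def)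
    ultimately show "ys \<in> {xs \<in> permutations_of_set {1..r}. dominates 0 (map (shifted_entry r) xs)}"
      using xs assms by (auto simp: arrangements_def permutations_of_set_def shifted_entry_def of_nat_diff)
  qed
  then show ?thesis
    using card_arrangements[of 2 r] assms by (simp add: card_image)
qed

lemma bij_betw_permutations_of_set:
  "bij_betw (\<lambda>p. map p [1..<Suc r]) {p. p permutes {1..r}} (permutations_of_set {1..r})"
proof (rule bij_betwI')
  fix p q assume pq: "p \<in> {p. p permutes {1..r}}" "q \<in> {p. p permutes {1..r}}"
  show "map p [1..<Suc r] = map q [1..<Suc r] \<longleftrightarrow> p = q"
  proof
    assume "map p [1..<Suc r] = map q [1..<Suc r]"
    then have "\<forall>i\<in>set [1..<Suc r]. p i = q i" by (simp only: map_eq_conv)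
    then have "p i = q i" if "i \<in> {1..r}" for i using that by (simp del: upt_Suc)
    moreover have "p i = q i" if "i \<notin> {1..r}" for i using that pq by (simp add: permutes_not_in)
    ultimately show "p = q" by blast
  qed simp
next
  fix p assume "p \<in> {p. p permutes {1..r}}"
  then have "p permutes {1..r}" by simp
  then have "p ` {1..r} = {1..r}" "inj_on p {1..r}"
    by (auto simp: permutes_image permutes_inj_on)
  moreover have "{1..<Suc r} = {1..r}" by auto
  ultimately show "map p [1..<Suc r] \<in> permutations_of_set {1..r}"
    by (simp add: permutations_of_set_def distinct_map del: upt_Suc)
next
  fix xs assume xs: "xs \<in> permutations_of_set {1..r}"
  define p where "p i = (if i \<in> {1..r} then xs ! (i - 1) else i)" for i
  have len: "length xs = r" using length_permutation[OF xs] by simp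
  have map: "map p [1..<Suc r] = xs"
    by (rule nth_equalityI) (auto simp: len p_def simp del: upt_Suc)
  have "{1..<Suc r} = {1..r}" by auto
  then have "bij_betw p {1..r} {1..r}"
    using xs by (simp add: bij_betw_def permutations_of_set_def flip: map del: upt_Suc add: distinct_map)
  then have "p permutes {1..r}"
    by (rule bij_imp_permutes) (auto simp: p_def)
  with map show "\<exists>p\<in>{p. p permutes {1..r}}. xs = map p [1..<Suc r]" by blast
qed

section \<open>The alternation set\<close>

text \<open>The weight \<open>\<alpha>\<^sub>1 + \<dots> + \<alpha>\<^sub>r + \<rho>\<close>.\<close>

definition shifted_weight :: "nat \<Rightarrow> weight" where
  "shifted_weight r = (\<Sum>i = 1..r. simple_root r i) + half_sum_positive_roots r"

lemma shifted_entry_eq: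
  assumes "2 \<le> r" "k \<in> {1..r}"
  shows "shifted_entry r k = int (r + 1 - k) + (if k = 1 then 1 else 0) + (if k = r then 1 else 0)"
  using assms by (auto simp: shifted_entry_def max_def of_nat_diff)

lemma shifted_weight_nth:
  assumes "2 \<le> r"
  shows "shifted_weight r k = (if k \<in> {1..r} then of_int (shifted_entry r k) else 0)"
proof -
  have sum: "(\<Sum>i = 1..r. simple_root r i) = root_combination r (\<lambda>_. 1)"
    by (simp add: root_combination_def)
  show ?thesis
    unfolding shifted_weight_def sum plus_fun_apply
    using assms by (simp add: root_combination_nth half_sum_positive_roots_nth
        shifted_entry_eq[OF assms, unfolded One_nat_def])
qed

lemma shifted_weight_in_cartan_dual: "2 \<le> r \<Longrightarrow> shifted_weight r \<in> cartan_dual r"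
  by (simp add: cartan_dual_def shifted_weight_nth)

lemma shifted_entry_ge_2: "3 \<le> r \<Longrightarrow> 2 \<le> shifted_entry r i"
  by (simp add: shifted_entry_def)

lemma sum_shifted_entry_minus_rho:
  assumes "2 \<le> r" "p permutes {1..r}"
  shows "(\<Sum>k = 1..r. shifted_entry r (p k) - int (r + 1 - k)) = 2"
proof -
  have "(\<Sum>k = 1..r. shifted_entry r (p k)) = (\<Sum>k = 1..r. shifted_entry r k)"
    using sum.permute[OF assms(2), of "shifted_entry r"] by (simp add: comp_def)
  then have "(\<Sum>k = 1..r. shifted_entry r (p k) - int (r + 1 - k)) =
      (\<Sum>k = 1..r. shifted_entry r k - int (r + 1 - k))"
    by (simp only: sum_subtractf)
  also have "\<dots> = (\<Sum>k = 1..r. (if k = 1 then 1 else 0) + (if k = r then 1 else 0))"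
    by (rule sum.cong[OF refl], subst shifted_entry_eq[OF assms(1)]) simp_all
  also have "\<dots> = 2"
    using assms(1) by (simp add: sum.distrib)
  finally show ?thesis .
qed

lemma kostant_partition_signed_perm_pos_iff:
  fixes r :: nat and t :: "nat \<Rightarrow> int"
  defines "z \<equiv> \<lambda>p t k. t k * shifted_entry r (p k) - int (r + 1 - k)"
  assumes r: "2 \<le> r" and p: "p permutes {1..r}" and s: "\<And>k. s k = of_int (t k)"
  shows "0 < kostant_partition r (signed_perm_action r s p (shifted_weight r) - half_sum_positive_roots r)
    \<longleftrightarrow> (\<forall>k\<in>{1..r}. 0 \<le> (\<Sum>i = 1..k. z p t i)) \<and> even (\<Sum>i = 1..r. z p t i)"
  unfolding kostant_partition_pos_iff
proof (rule root_combination_iff_partial_sums)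
  have nth: "signed_perm_action r s p (shifted_weight r) k = s k * shifted_weight r (p k)" for k
    using shifted_weight_in_cartan_dual[OF r] by (simp add: signed_perm_action_def)
  show "signed_perm_action r s p (shifted_weight r) - half_sum_positive_roots r \<in> cartan_dual r"
    using permutes_not_in[OF p] r
    by (auto simp: cartan_dual_def nth shifted_weight_nth half_sum_positive_roots_nth)
  fix k assume k: "k \<in> {1..r}"
  then have "p k \<in> {1..r}" using p by (simp only: permutes_in_image)
  with k show "(signed_perm_action r s p (shifted_weight r) - half_sum_positive_roots r) k = of_int (z p t k)"
    using r by (simp add: nth shifted_weight_nth half_sum_positive_roots_nth s z_def)
qed (use r in simp)

lemma dominates_perm_iff:
  "dominates 0 (map (shifted_entry r) (map p [1..<Suc r])) \<longleftrightarrow>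
    (\<forall>k\<in>{1..r}. 0 \<le> (\<Sum>i = 1..k. shifted_entry r (p i) - int (r + 1 - i)))"
proof -
  have "(\<Sum>i = 1..k. map (shifted_entry r) (map p [1..<Suc r]) ! (i - 1) - int (r + 1 - i)) =
      (\<Sum>i = 1..k. shifted_entry r (p i) - int (r + 1 - i))" if "k \<in> {1..r}" for k
    using that by (intro sum.cong) (auto simp del: upt_Suc)
  moreover have "length (map (shifted_entry r) (map p [1..<Suc r])) = r" by simp
  ultimately show ?thesis
    unfolding dominates_iff_partial_sums by (simp del: upt_Suc)
qed

lemma kostant_partition_perm_pos_iff:
  assumes "2 \<le> r" "p permutes {1..r}"
  shows "0 < kostant_partition r (perm_action r p (shifted_weight r) - half_sum_positive_roots r)
    \<longleftrightarrow> dominates 0 (map (shifted_entry r) (map p [1..<Suc r]))"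
proof -
  have "(1 :: complex) = of_int 1" by simp
  from kostant_partition_signed_perm_pos_iff[OF assms, of "\<lambda>_. 1" "\<lambda>_. 1", OF this]
  show ?thesis
    by (simp only: dominates_perm_iff mult_1_left sum_shifted_entry_minus_rho[OF assms]
        even_numeral simp_thms)
qed

text \<open>No sign of an element of the alternation set is negative: the unsigned total is 2, and a
  negative sign in front of an entry, which is at least 2, lowers the total by at least 4.\<close>

lemma kostant_partition_signed_perm_posD:
  assumes r: "3 \<le> r" and p: "p permutes {1..r}" and s: "\<And>k. s k \<in> {1, - 1}"
    and pos: "0 < kostant_partition r (signed_perm_action r s p (shifted_weight r) - half_sum_positive_roots r)"
  shows "signed_perm_action r s p = perm_action r p"
proof -
  have r2: "2 \<le> r" using r by simp
  define t :: "nat \<Rightarrow> int" where "t k = (if s k = 1 then 1 else - 1)" for k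
  have st: "s k = of_int (t k)" for k using s[of k] by (auto simp: t_def)
  have "0 \<le> (\<Sum>k = 1..r. t k * shifted_entry r (p k) - int (r + 1 - k))"
    using kostant_partition_signed_perm_pos_iff[OF r2 p st] pos r by simp
  also have "\<dots> = (\<Sum>k = 1..r. (shifted_entry r (p k) - int (r + 1 - k)) - (1 - t k) * shifted_entry r (p k))"
    by (intro sum.cong) (auto simp: algebra_simps)
  also have "\<dots> = 2 - (\<Sum>k = 1..r. (1 - t k) * shifted_entry r (p k))"
    unfolding sum_subtractf[of _ "\<lambda>k. (1 - t k) * shifted_entry r (p k)"]
    by (simp only: sum_shifted_entry_minus_rho[OF r2 p])
  finally have bound: "(\<Sum>k = 1..r. (1 - t k) * shifted_entry r (p k)) \<le> 2" by simp
  have s1: "s k = 1" if k: "k \<in> {1..r}" for k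
  proof (rule ccontr)
    assume "s k \<noteq> 1"
    then have "4 \<le> (1 - t k) * shifted_entry r (p k)"
      using shifted_entry_ge_2[OF r, of "p k"] by (simp add: t_def)
    also have "\<dots> \<le> (\<Sum>k = 1..r. (1 - t k) * shifted_entry r (p k))"
    proof (rule member_le_sum[OF k])
      fix i
      show "0 \<le> (1 - t i) * shifted_entry r (p i)"
        using shifted_entry_ge_2[OF r, of "p i"] by (simp add: t_def)
    qed simp
    finally show False using bound by simp
  qed
  have "s k * \<xi> (p k) = \<xi> (p k)" if "\<xi> \<in> cartan_dual r" for \<xi> k
  proof (cases "k \<in> {1..r}")
    case False
    then have "\<xi> (p k) = 0" using that permutes_not_in[OF p False] by (auto simp: cartan_dual_def)
    then show ?thesis by simp
  qed (simp add: s1)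
  then show ?thesis
    by (auto simp: signed_perm_action_def fun_eq_iff restrict_def)
qed

lemma weyl_alternation_set_eq:
  assumes r: "3 \<le> r"
  shows "weyl_alternation_set r (\<Sum>i = 1..r. simple_root r i) 0 =
    perm_action r ` {p. p permutes {1..r} \<and> dominates 0 (map (shifted_entry r) (map p [1..<Suc r]))}"
proof -
  have r2: "2 \<le> r" using r by simp
  have "weyl_alternation_set r (\<Sum>i = 1..r. simple_root r i) 0 =
    {\<sigma> \<in> weyl_group r. 0 < kostant_partition r (\<sigma> (shifted_weight r) - half_sum_positive_roots r)}"
    by (simp add: weyl_alternation_set_def shifted_weight_def)
  also have "\<dots> = perm_action r ` {p. p permutes {1..r} \<and>
      dominates 0 (map (shifted_entry r) (map p [1..<Suc r]))}"
  proof (intro equalityI subsetI)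
    fix \<sigma>
    assume "\<sigma> \<in> {\<sigma> \<in> weyl_group r. 0 < kostant_partition r (\<sigma> (shifted_weight r) - half_sum_positive_roots r)}"
    then have \<sigma>: "\<sigma> \<in> weyl_group r"
      "0 < kostant_partition r (\<sigma> (shifted_weight r) - half_sum_positive_roots r)" by auto
    obtain s p where p: "p permutes {1..r}" and "\<forall>k. s k \<in> {1, - 1}" "\<sigma> = signed_perm_action r s p"
      using weyl_group_signed_perm[OF \<sigma>(1)] by blast
    then have eq: "\<sigma> = perm_action r p"
      using kostant_partition_signed_perm_posD[OF r p, of s] \<sigma>(2) by blast
    have "dominates 0 (map (shifted_entry r) (map p [1..<Suc r]))"
      using \<sigma>(2) unfolding eq kostant_partition_perm_pos_iff[OF r2 p] .
    with p eq show "\<sigma> \<in> perm_action r ` {p. p permutes {1..r} \<and>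
        dominates 0 (map (shifted_entry r) (map p [1..<Suc r]))}" by blast
  next
    fix \<sigma>
    assume "\<sigma> \<in> perm_action r ` {p. p permutes {1..r} \<and>
        dominates 0 (map (shifted_entry r) (map p [1..<Suc r]))}"
    then obtain p where p: "p permutes {1..r}" "\<sigma> = perm_action r p"
        "dominates 0 (map (shifted_entry r) (map p [1..<Suc r]))" by blast
    then show "\<sigma> \<in> {\<sigma> \<in> weyl_group r. 0 < kostant_partition r (\<sigma> (shifted_weight r) - half_sum_positive_roots r)}"
      using perm_action_in_weyl_group[OF p(1)] kostant_partition_perm_pos_iff[OF r2 p(1)] by blast
  qed
  finally show ?thesis .
qed

theorem theorem3p9:
  fixes r :: nat
  assumes "r \<ge> 3"
  shows "card (weyl_alternation_set r (\<Sum>i = 1..r. simple_root r i) 0) = F_tilde (r - 2)"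
proof -
  let ?P = "{p. p permutes {1..r} \<and> dominates 0 (map (shifted_entry r) (map p [1..<Suc r]))}"
  let ?L = "{xs \<in> permutations_of_set {1..r}. dominates 0 (map (shifted_entry r) xs)}"
  have "inj_on (perm_action r) ?P"
    by (rule inj_onI) (blast intro: perm_action_inj)
  then have "card (weyl_alternation_set r (\<Sum>i = 1..r. simple_root r i) 0) = card ?P"
    unfolding weyl_alternation_set_eq[OF assms] by (rule card_image)
  also have "card ?P = card ?L"
  proof (rule bij_betw_same_card)
    have bij: "inj_on (\<lambda>p. map p [1..<Suc r]) {p. p permutes {1..r}}"
        "(\<lambda>p. map p [1..<Suc r]) ` {p. p permutes {1..r}} = permutations_of_set {1..r}"
      using bij_betw_permutations_of_set[of r] by (simp_all only: bij_betw_def)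
    have "(\<lambda>p. map p [1..<Suc r]) ` ?P = ?L"
      unfolding bij(2)[symmetric] by blast
    moreover have "inj_on (\<lambda>p. map p [1..<Suc r]) ?P"
      by (rule inj_on_subset[OF bij(1)]) blast
    ultimately show "bij_betw (\<lambda>p. map p [1..<Suc r]) ?P ?L"
      by (simp only: bij_betw_def)
  qed
  also have "card ?L = F_tilde (r - 2)"
    by (rule card_dominating_permutations[OF assms])
  finally show ?thesis .
qed

end
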